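(* Let $K$ be a field of characteristic zero and let $R$ be a unitary associative algebra over $K$. If the polynomial algebra $R[z]$ is isomorphic as a $K$-algebra to the polynomial algebra $K[x,y]$ in two commuting variables, then $R$ is isomorphic as a $K$-algebra to the polynomial algebra $K[x]$ in one variable.
   Context: Algebras are associative with unit, and $K$-isomorphic means isomorphic as unital $K$-algebras. $R[z]$ denotes the algebra of polynomials in one variable $z$ with coefficients in $R$, where $z$ commutes with the elements of $R$. *)

theory Defs
  imports "HOL-Library.Poly_Mapping" "HOL-Computational_Algebra.Computational_Algebra"
begin

locale unital_algebra = vector_space scale
  for scale :: "'k::field \<Rightarrow> 'a::ring_1 \<Rightarrow> 'a" +
  assumes scale_mult_left: "scale c x * y = scale c (x * y)"
    and scale_mult_right: "x * scale c y = scale c (x * y)"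

definition algebra_isomorphic ::
  "('k::field \<Rightarrow> 'a::ring_1 \<Rightarrow> 'a) \<Rightarrow> ('k \<Rightarrow> 'b::ring_1 \<Rightarrow> 'b) \<Rightarrow> bool"
  where "algebra_isomorphic s1 s2 \<longleftrightarrow>
    (\<exists>f. bij f \<and> f 1 = 1 \<and> (\<forall>x y. f (x + y) = f x + f y) \<and>
         (\<forall>x y. f (x * y) = f x * f y) \<and> (\<forall>c x. f (s1 c x) = s2 c (f x)))"

text \<open>
  The ring structure of \<^typ>\<open>'a poly\<close> requires commutative coefficients. Over a possibly
  noncommutative ring \<^typ>\<open>'r\<close> the polynomial ring in a central variable \<open>z\<close> is
  \<^typ>\<open>nat \<Rightarrow>\<^sub>0 'r\<close> with its convolution product; \<open>single n a\<close> is the monomial \<open>a z^n\<close>.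
  A scalar multiplication on \<^typ>\<open>'r\<close> extends to it coefficientwise.
\<close>

definition central_poly_scale ::
  "('k \<Rightarrow> 'r \<Rightarrow> 'r) \<Rightarrow> 'k \<Rightarrow> (nat \<Rightarrow>\<^sub>0 'r::ring_1) \<Rightarrow> (nat \<Rightarrow>\<^sub>0 'r)"
  where "central_poly_scale scale c = Poly_Mapping.map (scale c)"

text \<open>
  \<open>K[x,y]\<close> is \<open>K[x][y]\<close>, i.e. \<^typ>\<open>'k poly poly\<close>; an element \<open>c\<close> of \<open>K\<close> acts as
  multiplication by the constant polynomial \<open>c\<close>.
\<close>

definition bivariate_poly_scale :: "'k::field \<Rightarrow> 'k poly poly \<Rightarrow> 'k poly poly"
  where "bivariate_poly_scale c = smult [:c:]"

context unital_algebra
begin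

lemma lookup_central_poly_scale:
  "Poly_Mapping.lookup (central_poly_scale scale c p) n = scale c (Poly_Mapping.lookup p n)"
  by (simp add: central_poly_scale_def map.rep_eq when_def)

lemma central_poly_scale_eq:
  "central_poly_scale scale c p = Poly_Mapping.single 0 (scale c 1) * p"
proof -
  have "Poly_Mapping.map (scale c) p = Poly_Mapping.map ((*) (scale c 1)) p"
    by (rule poly_mapping_eqI) (simp add: map.rep_eq scale_mult_left when_def)
  then show ?thesis
    by (simp add: central_poly_scale_def mult_map_scale_conv_mult)
qed

lemma central_poly_single_commute:
  fixes p :: "nat \<Rightarrow>\<^sub>0 'a"
  assumes "\<And>b. a * b = b * a"
  shows "Poly_Mapping.single n a * p = p * Poly_Mapping.single n a"
proof (induction p rule: update_induct)
  case const
  show ?case by simp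
next
  case (update p m b)
  from \<open>m \<notin> Poly_Mapping.keys p\<close> have "Poly_Mapping.update m b p = Poly_Mapping.single m b + p"
    by (intro poly_mapping_eqI)
      (auto simp: lookup_update lookup_add lookup_single when_def in_keys_iff)
  with update.IH show ?case
    by (simp add: distrib_left distrib_right mult_single assms add.commute)
qed

lemma unital_algebra_central_poly: "unital_algebra (central_poly_scale scale)"
proof
  fix c d :: 'k and p q :: "nat \<Rightarrow>\<^sub>0 'a"
  show "central_poly_scale scale c (p + q) = central_poly_scale scale c p + central_poly_scale scale c q"
    "central_poly_scale scale (c + d) p = central_poly_scale scale c p + central_poly_scale scale d p"
    "central_poly_scale scale c (central_poly_scale scale d p) = central_poly_scale scale (c * d) p"
    "central_poly_scale scale 1 p = p"
    by (auto intro!: poly_mapping_eqI simp: lookup_central_poly_scale lookup_add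
        scale_right_distrib scale_left_distrib)
  show "central_poly_scale scale c p * q = central_poly_scale scale c (p * q)"
    by (simp add: central_poly_scale_eq mult.assoc)
  have "Poly_Mapping.single 0 (scale c 1) * p = p * Poly_Mapping.single 0 (scale c 1)"
    by (rule central_poly_single_commute) (simp add: scale_mult_left scale_mult_right)
  then show "p * central_poly_scale scale c q = central_poly_scale scale c (p * q)"
    by (simp add: central_poly_scale_eq flip: mult.assoc)
qed

lemma central_variable_commutes:
  "Poly_Mapping.single 1 1 * p = p * Poly_Mapping.single (1 :: nat) (1 :: 'a)"
  by (rule central_poly_single_commute) simp

end

lemma unital_algebra_poly: "unital_algebra (smult :: 'k::field \<Rightarrow> 'k poly \<Rightarrow> 'k poly)"
  by unfold_locales (simp_all add: smult_add_right smult_add_left)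

lemma unital_algebra_bivariate_poly: "unital_algebra (bivariate_poly_scale :: 'k::field \<Rightarrow> _)"
  by unfold_locales
    (simp_all add: bivariate_poly_scale_def smult_add_right pCons_one mult.commute flip: smult_add_left)

end

theory Submission
  imports Defs
begin

text \<open>
  Write \<open>B = K[x,y]\<close> and let \<open>A \<subseteq> B\<close> be the copy of \<open>R\<close> inside it, so that \<open>B = A[z]\<close>.
  The proof finds one \<open>f \<in> A\<close> that vanishes at the origin and divides, inside \<open>A\<close>, every element of
  \<open>A\<close> vanishing at the origin. Given such an \<open>f\<close>, any \<open>a \<in> A\<close> is \<open>a(0,0) + f a'\<close> with \<open>a' \<in> A\<close> of
  smaller degree, and iterating this shows \<open>A = K[f]\<close> (lemma \<open>generated_by_f\<close>).

  Let \<open>m\<close> be the ideal of all elements of \<open>A\<close> that vanish at the origin. Evaluating the coefficients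
  of a polynomial in \<open>z\<close> at the origin is a homomorphism \<open>\<psi>\<close> from \<open>B = A[z]\<close> onto \<open>(A/m)[z] = K[z]\<close>.
  A \<open>K\<close>-algebra homomorphism from \<open>K[x,y]\<close> to \<open>K[z]\<close> whose image is larger than \<open>K\<close> has a
  principal kernel (lemma \<open>kernel_principal\<close>): this is where it matters
  that \<open>B\<close> is the polynomial ring, and it is an instance of the fact that the primes of
  height at most one in a factorial ring are principal. So \<open>ker \<psi> = f B\<close>. Since \<open>A\<close> is closed under taking
  factors in \<open>A[z]\<close>, the generator lies in \<open>A\<close> as soon as \<open>m \<noteq> 0\<close>, and then \<open>m = f A\<close>.
  Finally \<open>m \<noteq> 0\<close>: otherwise \<open>A = K\<close>, so that \<open>B = K[z]\<close>, and then \<open>z - z(0,0)\<close> would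
  be a common factor of \<open>x\<close> and \<open>y\<close> that vanishes at the origin.
\<close>

section \<open>Unital ring homomorphisms\<close>

locale unital_ring_hom =
  fixes h :: "'a::comm_ring_1 \<Rightarrow> 'b::comm_ring_1"
  assumes hom_add: "h (x + y) = h x + h y"
    and hom_mult: "h (x * y) = h x * h y"
    and hom_one: "h 1 = 1"
begin

lemma hom_zero [simp]: "h 0 = 0"
  using hom_add[of 0 0] by simp

lemma hom_minus: "h (- x) = - h x"
  using hom_add[of x "- x"] by (simp add: eq_neg_iff_add_eq_0 add.commute)

lemma hom_diff: "h (x - y) = h x - h y"
  using hom_add[of x "- y"] by (simp add: hom_minus)

lemma hom_sum: "h (sum g S) = (\<Sum>i\<in>S. h (g i))"
  by (induction S rule: infinite_finite_induct) (simp_all add: hom_add)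

lemma hom_power: "h (x ^ n) = h x ^ n"
  by (induction n) (simp_all add: hom_one hom_mult)

lemma unital_ring_hom_map_poly: "unital_ring_hom (map_poly h)"
proof
  fix p q :: "'a poly"
  show "map_poly h (p + q) = map_poly h p + map_poly h q"
    by (rule poly_eqI) (simp add: coeff_map_poly hom_add)
  show "map_poly h (p * q) = map_poly h p * map_poly h q"
    by (rule poly_eqI) (simp add: coeff_map_poly coeff_mult hom_sum hom_mult)
  show "map_poly h 1 = 1"
    by (simp add: hom_one)
qed

lemma unital_ring_hom_poly_map_poly: "unital_ring_hom (\<lambda>p. poly (map_poly h p) c)"
proof -
  interpret map: unital_ring_hom "map_poly h" by (rule unital_ring_hom_map_poly)
  show ?thesis
    by unfold_locales (simp_all add: map.hom_add map.hom_mult map.hom_one)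
qed

end

section \<open>Scalars, the origin and degrees in the ring of bivariate polynomials\<close>

definition scalar :: "'k::field \<Rightarrow> 'k poly poly"
  where "scalar c = [:[:c:]:]"

definition at_origin :: "'k::field poly poly \<Rightarrow> 'k"
  where "at_origin p = coeff (coeff p 0) 0"

interpretation scalar: unital_ring_hom scalar
  by unfold_locales (simp_all add: scalar_def one_pCons)

interpretation at_origin: unital_ring_hom at_origin
  by unfold_locales (simp_all add: at_origin_def coeff_mult_0)

lemma at_origin_scalar [simp]: "at_origin (scalar c) = c"
  by (simp add: at_origin_def scalar_def)

text \<open>
  The lexicographically leading exponents, added up. Unlike for the total degree, additivity is
  immediate from the additivity of \<open>degree\<close> and the multiplicativity of \<open>lead_coeff\<close>.
\<close>

definition lex_degree :: "'k::field poly poly \<Rightarrow> nat"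
  where "lex_degree p = degree p + degree (lead_coeff p)"

lemma lex_degree_mult:
  "p \<noteq> 0 \<Longrightarrow> q \<noteq> 0 \<Longrightarrow> lex_degree (p * q) = lex_degree p + lex_degree q"
  unfolding lex_degree_def lead_coeff_mult by (simp add: degree_mult_eq)

lemma scalar_if_lex_degree_0:
  assumes "lex_degree p = 0"
  shows "p = scalar (at_origin p)"
  using assms by (auto simp: lex_degree_def scalar_def at_origin_def elim!: degree_eq_zeroE)

lemma lex_degree_diff_scalar: "lex_degree (p - scalar c) \<le> lex_degree p"
proof (cases p)
  case (pCons a q)
  then have eq: "p - scalar c = pCons (a - [:c:]) q" by (simp add: scalar_def)
  show ?thesis
  proof (cases "q = 0")
    case True
    then show ?thesis
      unfolding eq using degree_diff_le[of a "degree a" "[:c:]"] pCons by (simp add: lex_degree_def)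
  next
    case False
    then show ?thesis unfolding eq using pCons by (simp add: lex_degree_def)
  qed
qed

text \<open>
  A divisor of \<open>x\<close> lies in \<open>K[x]\<close>, and if it divides \<open>y\<close> too, then it divides the coefficient \<open>1\<close> of
  \<open>y\<close>. So it is a unit, that is, a nonzero scalar.
\<close>

lemma common_factor_of_variables:
  fixes t :: "'k::field poly poly"
  assumes "t dvd [:[:0, 1:]:]" and "t dvd [:0, 1:]"
  shows "at_origin t \<noteq> 0"
proof -
  have "degree t = 0"
    using dvd_imp_degree_le[OF assms(1)] by simp
  then obtain a where t: "t = [:a:]"
    by (auto elim: degree_eq_zeroE)
  with assms(2) have "a dvd coeff [:0, 1:] 1"
    by (simp only: const_poly_dvd_iff)
  then have "a dvd 1" by simp
  then show ?thesis
    by (auto simp: t at_origin_def is_unit_poly_iff)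
qed

section \<open>Kernels of homomorphisms to the univariate polynomial ring\<close>

lemma prime_factor_of_nonconstant:
  fixes a :: "'k::field poly"
  assumes "degree a > 0"
  obtains p where "prime_elem p" and "p dvd a" and "degree p > 0"
proof -
  define P where "P = (\<lambda>p. degree p > 0 \<and> p dvd a)"
  define p where "p = arg_min degree P"
  have "P a" using assms by (simp add: P_def)
  then have p: "P p" and min: "\<And>q. P q \<Longrightarrow> degree p \<le> degree q"
    using arg_min_nat_lemma[of P _ degree] by (auto simp: p_def)
  have "irreducible p"
  proof (rule irreducibleI)
    show "p \<noteq> 0" "\<not> p dvd 1"
      using p by (auto simp: P_def is_unit_poly_iff)
  next
    fix b c assume bc: "p = b * c"
    with p have nz: "b \<noteq> 0" "c \<noteq> 0" by (auto simp: P_def)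
    then have deg: "degree p = degree b + degree c"
      by (simp add: bc degree_mult_eq)
    have "degree b = 0 \<or> degree c = 0"
    proof (rule ccontr)
      assume "\<not> ?thesis"
      with p bc have "P b" by (auto simp: P_def dest: dvd_mult_left)
      from min[OF this] deg \<open>\<not> ?thesis\<close> show False by simp
    qed
    with nz show "b dvd 1 \<or> c dvd 1"
      by (auto simp: is_unit_iff_degree)
  qed
  then have "prime_elem p" by (rule field_poly_irreducible_imp_prime)
  with p show ?thesis using that by (simp add: P_def)
qed

text \<open>
  This is a form of Gauss's lemma. A prime factor of \<open>a\<close> in \<open>K[x]\<close> stays prime in \<open>K[x][y]\<close> and does
  not divide \<open>f\<close>, so it divides \<open>q\<close> and can be cancelled; this lowers the degree of \<open>a\<close>.
\<close>

lemma primitive_dvd_smult_imp_dvd: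
  fixes f g :: "'k::field poly poly"
  assumes primitive: "\<And>c. [:c:] dvd f \<Longrightarrow> degree c = 0"
    and "a \<noteq> 0" and "smult a g = f * q"
  shows "f dvd g"
  using assms(2,3)
proof (induction "degree a" arbitrary: a q rule: less_induct)
  case less
  show ?case
  proof (cases "degree a = 0")
    case True
    with less.prems obtain c where a: "a = [:c:]" "c \<noteq> 0"
      by (auto elim: degree_eq_zeroE)
    have "f * smult [:inverse c:] q = smult [:inverse c:] (smult a g)"
      by (simp add: less.prems)
    also have "\<dots> = g"
      using a by (simp add: one_pCons[symmetric])
    finally show ?thesis by (metis dvd_triv_left)
  next
    case False
    then obtain p where p: "prime_elem p" "p dvd a" "degree p > 0"
      by (auto elim: prime_factor_of_nonconstant)
    then obtain a' where a': "a = p * a'" by (auto elim: dvdE)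
    have "prime_elem [:p:]" using p(1) by (rule lift_prime_elem_poly)
    moreover have "[:p:] dvd f * q"
      using less.prems(2) p(2) by (metis const_poly_dvd_iff coeff_smult dvd_mult2)
    moreover have "\<not> [:p:] dvd f"
      using primitive p(3) by fastforce
    ultimately have "[:p:] dvd q"
      by (auto dest: prime_elem_dvd_multD)
    then obtain q' where q': "q = smult p q'" by (auto elim: dvdE)
    have nz: "p \<noteq> 0" "a' \<noteq> 0" using less.prems(1) a' by auto
    have "smult p (smult a' g) = smult p (f * q')"
      using less.prems(2) by (simp add: a' q')
    with nz have "smult a' g = f * q'"
      by (metis smult_cancel)
    moreover have "degree a' < degree a"
      using nz p(3) by (simp add: a' degree_mult_eq)
    ultimately show ?thesis using less.hyps nz(2) by blast
  qed
qed

locale hom_to_univariate = unital_ring_hom \<psi>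
  for \<psi> :: "'k::field poly poly \<Rightarrow> 'k poly" +
  assumes hom_scalar: "\<psi> (scalar c) = [:c:]"
begin

lemma hom_pCons: "\<psi> (pCons a p) = \<psi> [:a:] + \<psi> [:0, 1:] * \<psi> p"
proof -
  have "pCons a p = [:a:] + [:0, 1:] * p" by simp
  then show ?thesis by (simp only: hom_add hom_mult)
qed

lemma hom_x_part: "\<psi> [:a:] = pcompose a (\<psi> [:[:0, 1:]:])"
proof (induction a)
  case (pCons c a)
  have "[:pCons c a:] = scalar c + [:[:0, 1:]:] * [:a:]"
    by (simp add: scalar_def)
  then have "\<psi> [:pCons c a:] = \<psi> (scalar c) + \<psi> [:[:0, 1:]:] * \<psi> [:a:]"
    by (simp only: hom_add hom_mult)
  then show ?case by (simp add: hom_scalar pcompose_pCons pCons.IH)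
qed simp

lemma hom_y_part: "\<psi> (map_poly (\<lambda>c. [:c:]) s) = pcompose s (\<psi> [:0, 1:])"
proof (induction s)
  case (pCons c s)
  have "map_poly (\<lambda>c. [:c:]) (pCons c s) = pCons [:c:] (map_poly (\<lambda>c. [:c:]) s)"
    by (simp add: map_poly_pCons)
  then have "\<psi> (map_poly (\<lambda>c. [:c:]) (pCons c s)) = \<psi> (scalar c) + \<psi> [:0, 1:] * \<psi> (map_poly (\<lambda>c. [:c:]) s)"
    using hom_pCons[of "[:c:]" "map_poly (\<lambda>c. [:c:]) s"] by (simp only: scalar_def)
  then show ?case by (simp add: hom_scalar pcompose_pCons pCons.IH)
qed simp

lemma constant_if_variables_constant:
  assumes "degree (\<psi> [:[:0, 1:]:]) = 0" and "degree (\<psi> [:0, 1:]) = 0"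
  shows "degree (\<psi> b) = 0"
proof (induction b)
  case (pCons a b)
  have "degree (\<psi> [:a:]) = 0"
    using assms(1) by (simp add: hom_x_part[of a] degree_pcompose)
  moreover have "degree (\<psi> [:0, 1:] * \<psi> b) = 0"
    using degree_mult_le[of "\<psi> [:0, 1:]" "\<psi> b"] assms(2) pCons.IH by simp
  ultimately show ?case
    using degree_add_le[of "\<psi> [:a:]" 0 "\<psi> [:0, 1:] * \<psi> b"] by (simp add: hom_pCons[of a b])
qed simp

text \<open>
  If the image of \<open>x\<close> is a constant \<open>c\<close>, then \<open>x - c\<close> is in the kernel, and modulo \<open>x - c\<close> every
  polynomial is one in \<open>y\<close> alone, on which the homomorphism is injective.
\<close>

lemma kernel_if_x_constant:
  assumes X: "\<psi> [:[:0, 1:]:] = [:c:]" and Y: "degree (\<psi> [:0, 1:]) > 0"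
  shows "\<psi> g = 0 \<longleftrightarrow> [:[:- c, 1:]:] dvd g"
proof
  have "[:[:- c, 1:]:] = [:[:0, 1:]:] - scalar c"
    by (simp add: scalar_def)
  then have ker: "\<psi> [:[:- c, 1:]:] = 0"
    by (simp only: hom_diff hom_scalar X) simp
  then show "\<psi> g = 0" if "[:[:- c, 1:]:] dvd g"
    using that by (metis dvdE hom_mult mult_zero_left)
  assume g: "\<psi> g = 0"
  define s where "s = map_poly (\<lambda>a. poly a c) g"
  define r where "r = map_poly (\<lambda>c. [:c:]) s"
  have "coeff r n = [:poly (coeff g n) c:]" for n
    by (simp add: r_def s_def coeff_map_poly)
  then have gr: "[:[:- c, 1:]:] dvd g - r"
    by (simp add: const_poly_dvd_iff poly_eq_0_iff_dvd[symmetric])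
  then have "\<psi> (g - r) = 0"
    using ker by (metis dvdE hom_mult mult_zero_left)
  with g have "pcompose s (\<psi> [:0, 1:]) = 0"
    by (simp add: hom_diff r_def hom_y_part)
  with Y have "s = 0" by (rule pcompose_eq_0[rotated])
  with gr show "[:[:- c, 1:]:] dvd g" by (simp add: r_def)
qed

text \<open>
  If the image of \<open>x\<close> is not constant, then the homomorphism is injective on \<open>K[x]\<close>. A nonzero
  element \<open>f\<close> of the kernel that is minimal, first in its degree in \<open>y\<close> and then in the degree of
  its leading coefficient, is primitive and divides every element of the kernel up to a factor from
  \<open>K[x]\<close>, by pseudo-division.
\<close>

lemma kernel_if_x_nonconstant:
  assumes X: "degree (\<psi> [:[:0, 1:]:]) > 0"
  shows "\<exists>f. \<forall>g. \<psi> g = 0 \<longleftrightarrow> f dvd g"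
proof (cases "\<exists>g. g \<noteq> 0 \<and> \<psi> g = 0")
  case False
  then have "\<forall>g. \<psi> g = 0 \<longleftrightarrow> 0 dvd g" by auto
  then show ?thesis ..
next
  case True
  then obtain g0 where g0: "g0 \<noteq> 0" "\<psi> g0 = 0" by blast
  have inj: "a = 0" if "\<psi> [:a:] = 0" for a
    using that X pcompose_eq_0 by (metis hom_x_part)
  define P where "P = (\<lambda>f. f \<noteq> 0 \<and> \<psi> f = 0)"
  define d where "d = degree (arg_min degree P)"
  have "P g0" using g0 by (simp add: P_def)
  then have P1: "P (arg_min degree P)" and d_min: "\<And>g. P g \<Longrightarrow> d \<le> degree g"
    using arg_min_nat_lemma[of P _ degree] by (auto simp: d_def)
  define Q where "Q = (\<lambda>f. P f \<and> degree f = d)"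
  define f where "f = arg_min (\<lambda>f. degree (lead_coeff f)) Q"
  have "Q (arg_min degree P)" using P1 by (simp add: Q_def d_def)
  then have Qf: "Q f"
    and f_min: "\<And>g. Q g \<Longrightarrow> degree (lead_coeff f) \<le> degree (lead_coeff g)"
    using arg_min_nat_lemma[of Q _ "\<lambda>f. degree (lead_coeff f)"] by (auto simp: f_def)
  then have f: "f \<noteq> 0" "\<psi> f = 0" "degree f = d"
    by (auto simp: Q_def P_def)
  have primitive: "degree c = 0" if cf: "[:c:] dvd f" for c
  proof -
    from cf obtain f' where f': "f = smult c f'" by (auto elim: dvdE)
    with f(1) have nz: "c \<noteq> 0" "f' \<noteq> 0" by auto
    have "f = [:c:] * f'" by (simp add: f')
    then have "\<psi> [:c:] * \<psi> f' = 0" using f(2) by (simp only: hom_mult)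
    with nz inj have "\<psi> f' = 0" by auto
    with nz f' f(3) have "Q f'" by (simp add: Q_def P_def)
    from f_min[OF this] have "degree (c * lead_coeff f') \<le> degree (lead_coeff f')"
      using nz by (simp add: f')
    with nz show ?thesis by (simp add: degree_mult_eq)
  qed
  have "f dvd g" if g: "\<psi> g = 0" for g
  proof -
    obtain q r where qr: "pseudo_divmod g f = (q, r)" by fastforce
    define a where "a = coeff f (degree f) ^ (Suc (degree g) - degree f)"
    from pseudo_divmod[OF f(1) qr]
    have div: "smult a g = f * q + r" and r: "r = 0 \<or> degree r < degree f"
      by (simp_all add: a_def)
    have "r = [:a:] * g - f * q" by (simp add: div)
    then have "\<psi> r = 0"
      by (simp only: hom_diff hom_mult f(2) g) simp
    with r d_min[of r] f(3) have "r = 0" unfolding P_def by linarith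
    with div have "smult a g = f * q" by simp
    moreover have "a \<noteq> 0" using f(1) by (simp add: a_def)
    ultimately show ?thesis using primitive_dvd_smult_imp_dvd primitive by blast
  qed
  moreover have "\<psi> g = 0" if "f dvd g" for g
    using that f(2) by (metis dvdE hom_mult mult_zero_left)
  ultimately show ?thesis by blast
qed

lemma kernel_principal:
  assumes "degree (\<psi> b) > 0"
  shows "\<exists>f. \<forall>g. \<psi> g = 0 \<longleftrightarrow> f dvd g"
proof (cases "degree (\<psi> [:[:0, 1:]:]) = 0")
  case True
  then obtain c where "\<psi> [:[:0, 1:]:] = [:c:]" by (auto elim: degree_eq_zeroE)
  moreover from True assms have "degree (\<psi> [:0, 1:]) > 0"
    using constant_if_variables_constant[of b] by auto
  ultimately show ?thesis using kernel_if_x_constant by blast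
next
  case False
  then show ?thesis by (intro kernel_if_x_nonconstant) simp
qed

end

section \<open>Subrings over which the whole ring is a polynomial ring\<close>

locale polynomial_over_subring =
  fixes A :: "'b::idom set" and z :: 'b
  assumes one_mem: "1 \<in> A"
    and add_mem: "a \<in> A \<Longrightarrow> b \<in> A \<Longrightarrow> a + b \<in> A"
    and minus_mem: "a \<in> A \<Longrightarrow> - a \<in> A"
    and mult_mem: "a \<in> A \<Longrightarrow> b \<in> A \<Longrightarrow> a * b \<in> A"
    and generated: "\<exists>p. (\<forall>n. coeff p n \<in> A) \<and> poly p z = b"
    and independent: "(\<And>n. coeff p n \<in> A) \<Longrightarrow> poly p z = 0 \<Longrightarrow> p = 0"
begin

lemma zero_mem: "0 \<in> A"
  using add_mem[OF one_mem minus_mem[OF one_mem]] by (simp only: add.right_inverse)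

lemma diff_mem: "a \<in> A \<Longrightarrow> b \<in> A \<Longrightarrow> a - b \<in> A"
  using add_mem[OF _ minus_mem] by (simp only: diff_conv_add_uminus)

lemma sum_mem: "(\<And>i. i \<in> S \<Longrightarrow> g i \<in> A) \<Longrightarrow> sum g S \<in> A"
  by (induction S rule: infinite_finite_induct)
    (simp_all add: zero_mem add_mem)

definition expansion :: "'b \<Rightarrow> 'b poly"
  where "expansion b = (SOME p. (\<forall>n. coeff p n \<in> A) \<and> poly p z = b)"

lemma coeff_expansion_mem: "coeff (expansion b) n \<in> A"
  and poly_expansion: "poly (expansion b) z = b"
  using someI_ex[OF generated[of b]] unfolding expansion_def[symmetric] by simp_all

lemma expansion_eqI:
  assumes "\<And>n. coeff p n \<in> A" and "poly p z = b"
  shows "expansion b = p"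
proof -
  have "expansion b - p = 0"
    by (rule independent) (simp_all add: assms coeff_expansion_mem diff_mem poly_expansion)
  then show ?thesis by simp
qed

lemma coeff_mult_mem:
  "(\<And>n. coeff p n \<in> A) \<Longrightarrow> (\<And>n. coeff q n \<in> A) \<Longrightarrow> coeff (p * q) n \<in> A"
  unfolding coeff_mult by (intro sum_mem mult_mem)

lemma expansion_mem: "a \<in> A \<Longrightarrow> expansion a = [:a:]"
  by (rule expansion_eqI) (auto simp: coeff_pCons zero_mem split: nat.split)

lemma unital_ring_hom_expansion: "unital_ring_hom expansion"
proof
  fix b c
  show "expansion (b + c) = expansion b + expansion c"
    by (rule expansion_eqI) (simp_all add: coeff_expansion_mem add_mem poly_expansion)
  show "expansion (b * c) = expansion b * expansion c"
    by (rule expansion_eqI) (simp_all add: coeff_expansion_mem coeff_mult_mem poly_expansion)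
  show "expansion 1 = 1"
    using expansion_mem[OF one_mem] by (simp add: one_pCons)
qed

lemma expansion_variable: "expansion z = [:0, 1:]"
  by (rule expansion_eqI) (auto simp: coeff_pCons zero_mem one_mem split: nat.split)

text \<open>Degrees in \<open>z\<close> add up, so a factor of an element of degree \<open>0\<close> has degree \<open>0\<close>.\<close>

lemma factor_mem:
  assumes "a * b \<in> A" and "a * b \<noteq> 0"
  shows "a \<in> A"
proof -
  interpret expansion: unital_ring_hom expansion by (rule unital_ring_hom_expansion)
  have eq: "expansion a * expansion b = [:a * b:]"
    using expansion_mem[OF assms(1)] by (simp add: expansion.hom_mult)
  moreover from this assms(2) have "expansion a \<noteq> 0" "expansion b \<noteq> 0" by auto
  ultimately have "degree (expansion a) = 0"
    by (metis add_is_0 degree_mult_eq degree_pCons_0)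
  then obtain c where c: "expansion a = [:c:]" by (auto elim: degree_eq_zeroE)
  with poly_expansion[of a] have "a = c" by simp
  with coeff_expansion_mem[of a 0] c show ?thesis by simp
qed

end

section \<open>A subring of this kind in the bivariate polynomials has one generator\<close>

locale bivariate_over_subring = polynomial_over_subring A z
  for A :: "'k::field poly poly set" and z :: "'k poly poly" +
  assumes scalar_mem: "scalar c \<in> A"
begin

text \<open>
  Reducing the coefficients of \<open>B = A[z]\<close> modulo the vanishing ideal of the origin in \<open>A\<close>, whose
  residue field is \<open>K\<close>.
\<close>

definition reduction :: "'k poly poly \<Rightarrow> 'k poly"
  where "reduction b = map_poly at_origin (expansion b)"

lemma hom_to_univariate_reduction: "hom_to_univariate reduction"
proof -
  interpret expansion: unital_ring_hom expansion by (rule unital_ring_hom_expansion)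
  interpret map: unital_ring_hom "map_poly at_origin" by (rule at_origin.unital_ring_hom_map_poly)
  show ?thesis
    by unfold_locales
      (simp_all add: reduction_def expansion.hom_add map.hom_add expansion.hom_mult map.hom_mult
        expansion.hom_one map.hom_one expansion_mem scalar_mem map_poly_pCons)
qed

lemma reduction_mem: "a \<in> A \<Longrightarrow> reduction a = [:at_origin a:]"
  by (simp add: reduction_def expansion_mem map_poly_pCons)

text \<open>
  If \<open>A\<close> has no such element, then \<open>A\<close> consists of scalars, and every element of the ring is a
  polynomial in \<open>z\<close> with scalar coefficients. Those that vanish at the origin, in particular \<open>x\<close> and
  \<open>y\<close>, are then divisible by \<open>z - z(0,0)\<close>, which contradicts \<open>common_factor_of_variables\<close>.
\<close>

lemma exists_nonzero_vanishing: "\<exists>a\<in>A. a \<noteq> 0 \<and> at_origin a = 0"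
proof (rule ccontr)
  assume none: "\<not> ?thesis"
  have A: "a = scalar (at_origin a)" if "a \<in> A" for a
  proof -
    have "a - scalar (at_origin a) \<in> A" using that by (intro diff_mem scalar_mem)
    moreover have "at_origin (a - scalar (at_origin a)) = 0" by (simp add: at_origin.hom_diff)
    ultimately have "a - scalar (at_origin a) = 0" using none by blast
    then show ?thesis by simp
  qed
  define w where "w = at_origin z"
  have dvd: "z - scalar w dvd b" if b: "at_origin b = 0" for b
  proof -
    \<comment> \<open>The value of the expansion at a scalar is a scalar, and it must be the value of \<open>b\<close> at the origin.\<close>
    define p where "p = expansion b"
    have "poly p (scalar w) \<in> A"
      unfolding poly_altdef p_def
      by (intro sum_mem mult_mem coeff_expansion_mem) (simp add: scalar.hom_power[symmetric] scalar_mem)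
    then obtain u where u: "poly p (scalar w) = scalar u" using A by blast
    have "[:- scalar w, 1:] dvd p - [:poly p (scalar w):]"
      by (simp add: poly_eq_0_iff_dvd[symmetric])
    then obtain q where q: "p - [:poly p (scalar w):] = [:- scalar w, 1:] * q" by (auto elim: dvdE)
    from arg_cong[OF this, of "\<lambda>p. poly p z"]
    have "b - poly p (scalar w) = (z - scalar w) * poly q z"
      by (simp add: p_def poly_expansion algebra_simps)
    then have eq: "b - scalar u = (z - scalar w) * poly q z" by (simp only: u)
    from arg_cong[OF this, of at_origin]
    have "u = 0" by (simp add: b w_def at_origin.hom_diff at_origin.hom_mult)
    with eq show ?thesis by simp
  qed
  have "at_origin (z - scalar w) \<noteq> 0"
    by (intro common_factor_of_variables dvd) (simp_all add: at_origin_def)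
  then show False by (simp add: w_def at_origin.hom_diff)
qed

text \<open>
  The vanishing ideal of the origin in \<open>A\<close> is the contraction of the kernel of \<open>reduction\<close>, and it
  inherits the generator because \<open>A\<close> is closed under taking factors.
\<close>

lemma vanishing_ideal_principal:
  obtains f where "f \<in> A" and "f \<noteq> 0" and "at_origin f = 0"
    and "\<And>a. a \<in> A \<Longrightarrow> at_origin a = 0 \<Longrightarrow> \<exists>a'\<in>A. a = f * a'"
proof -
  interpret reduction: hom_to_univariate reduction by (rule hom_to_univariate_reduction)
  have "degree (reduction z) > 0"
    by (simp add: reduction_def expansion_variable map_poly_pCons at_origin.hom_one)
  then obtain f where f: "\<And>g. reduction g = 0 \<longleftrightarrow> f dvd g"
    using reduction.kernel_principal by blast
  have dvd: "f dvd a" if "a \<in> A" "at_origin a = 0" for a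
    using that f[of a] by (simp add: reduction_mem)
  obtain a where a: "a \<in> A" "a \<noteq> 0" "at_origin a = 0"
    using exists_nonzero_vanishing by blast
  from dvd[OF a(1,3)] obtain b where b: "a = f * b" by (auto elim: dvdE)
  with a have f_mem: "f \<in> A" and f_nz: "f \<noteq> 0" by (auto intro: factor_mem[of f b])
  moreover from f_mem have "at_origin f = 0"
    using f[of f] by (simp add: reduction_mem)
  moreover have "\<exists>a'\<in>A. a = f * a'" if a: "a \<in> A" "at_origin a = 0" for a
  proof (cases "a = 0")
    case True
    then show ?thesis using zero_mem by force
  next
    case False
    from dvd[OF a] obtain a' where a': "a = f * a'" by (auto elim: dvdE)
    with a False have "a' \<in> A" by (intro factor_mem[of a' f]) (simp_all add: mult.commute)
    with a' show ?thesis by blast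
  qed
  ultimately show ?thesis using that by blast
qed

text \<open>
  Splitting off the value at the origin and dividing by \<open>f\<close> lowers \<open>lex_degree\<close>, since \<open>f\<close> is not
  a scalar. In a polynomial relation for \<open>f\<close>, evaluation at the origin shows that the
  constant coefficient is zero, and then a factor \<open>f\<close> can be cancelled.
\<close>

lemma generated_by_f:
  obtains f where "inj (\<lambda>p. poly (map_poly scalar p) f)"
    and "range (\<lambda>p. poly (map_poly scalar p) f) = A"
proof -
  from vanishing_ideal_principal obtain f where f: "f \<in> A" "f \<noteq> 0" "at_origin f = 0"
    and div: "\<And>a. a \<in> A \<Longrightarrow> at_origin a = 0 \<Longrightarrow> \<exists>a'\<in>A. a = f * a'" by blast
  define ev where "ev = (\<lambda>p. poly (map_poly scalar p) f)"
  interpret ev: unital_ring_hom ev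
    unfolding ev_def by (rule scalar.unital_ring_hom_poly_map_poly)
  have ev_pCons: "ev (pCons c p) = scalar c + f * ev p" for c p
    by (simp add: ev_def map_poly_pCons)
  have "p = 0" if "ev p = 0" for p
    using that
  proof (induction p)
    case (pCons c p)
    then have eq: "scalar c + f * ev p = 0" by (simp add: ev_pCons)
    from arg_cong[OF this, of at_origin] have "c = 0"
      by (simp add: at_origin.hom_add at_origin.hom_mult f)
    with eq f have "ev p = 0" by simp
    with pCons.IH \<open>c = 0\<close> show ?case by simp
  qed simp
  then have "inj ev"
    by (intro injI) (metis ev.hom_diff right_minus_eq)
  moreover have "ev p \<in> A" for p
    by (induction p) (auto simp: ev_pCons intro: zero_mem add_mem mult_mem scalar_mem f)
  moreover have "a \<in> range ev" if "a \<in> A" for a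
    using that
  proof (induction "lex_degree a" arbitrary: a rule: less_induct)
    case less
    define c where "c = at_origin a"
    have "a - scalar c \<in> A" using less.prems by (intro diff_mem scalar_mem)
    moreover have "at_origin (a - scalar c) = 0" by (simp add: c_def at_origin.hom_diff)
    ultimately obtain a' where a': "a' \<in> A" "a - scalar c = f * a'" using div by blast
    show ?case
    proof (cases "lex_degree a = 0 \<or> a' = 0")
      case True
      then have "a = scalar c"
        using a'(2) scalar_if_lex_degree_0[of a] by (auto simp: c_def)
      then have "a = ev [:c:]" by (simp add: ev_pCons)
      then show ?thesis by blast
    next
      case False
      have "lex_degree f \<noteq> 0"
        using f scalar_if_lex_degree_0[of f] by auto
      moreover have "lex_degree (a - scalar c) \<le> lex_degree a"
        by (rule lex_degree_diff_scalar)
      moreover have "lex_degree (f * a') = lex_degree f + lex_degree a'"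
        using False f by (intro lex_degree_mult) auto
      ultimately have "lex_degree a' < lex_degree a" using a'(2) by simp
      with less.hyps a'(1) obtain p where "a' = ev p" by blast
      then have "a = ev (pCons c p)" using a'(2) by (simp add: ev_pCons algebra_simps)
      then show ?thesis by blast
    qed
  qed
  ultimately have "inj ev \<and> range ev = A" by blast
  then show ?thesis using that[of f] by (simp add: ev_def)
qed

end

section \<open>Transfer to the given algebra\<close>

lemma algebra_isomorphic_if_same_range:
  fixes \<iota> :: "'a::ring_1 \<Rightarrow> 'c::ring_1" and \<kappa> :: "'b::ring_1 \<Rightarrow> 'c"
  assumes "inj \<iota>" and "inj \<kappa>" and range: "range \<iota> = range \<kappa>"
    and \<iota>: "\<iota> 1 = 1" "\<And>x y. \<iota> (x + y) = \<iota> x + \<iota> y" "\<And>x y. \<iota> (x * y) = \<iota> x * \<iota> y"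
      "\<And>c x. \<iota> (s1 c x) = s c (\<iota> x)"
    and \<kappa>: "\<kappa> 1 = 1" "\<And>x y. \<kappa> (x + y) = \<kappa> x + \<kappa> y" "\<And>x y. \<kappa> (x * y) = \<kappa> x * \<kappa> y"
      "\<And>c x. \<kappa> (s2 c x) = s c (\<kappa> x)"
  shows "algebra_isomorphic s1 s2"
proof -
  define f where "f = inv \<kappa> \<circ> \<iota>"
  have \<kappa>f: "\<kappa> (f x) = \<iota> x" for x
    using range by (simp add: f_def f_inv_into_f flip: range)
  have f_eqI: "f x = y" if "\<iota> x = \<kappa> y" for x y
    using that \<open>inj \<kappa>\<close> by (simp add: f_def)
  have "inj f"
    by (intro injI) (metis \<kappa>f \<open>inj \<iota>\<close> injD)
  moreover have "surj f"
    unfolding surj_def using f_eqI range by (metis rangeE rangeI)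
  ultimately have "bij f" by (simp add: bij_def)
  moreover have "f 1 = 1" "f (x + y) = f x + f y" "f (x * y) = f x * f y" "f (s1 c x) = s2 c (f x)"
    for c x y
    by (rule f_eqI; simp add: \<iota> \<kappa> \<kappa>f)+
  ultimately show ?thesis unfolding algebra_isomorphic_def by blast
qed

theorem proposition1p4:
  fixes scale :: "'k::field_char_0 \<Rightarrow> 'r::ring_1 \<Rightarrow> 'r"
  assumes "unital_algebra scale"
    and "algebra_isomorphic (central_poly_scale scale)
           (bivariate_poly_scale :: 'k \<Rightarrow> 'k poly poly \<Rightarrow> 'k poly poly)"
  shows "algebra_isomorphic scale (smult :: 'k \<Rightarrow> 'k poly \<Rightarrow> 'k poly)"
proof -
  interpret unital_algebra scale by fact
  from assms(2) obtain F :: "(nat \<Rightarrow>\<^sub>0 'r) \<Rightarrow> 'k poly poly"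
    where F: "bij F" "F 1 = 1" "\<And>p q. F (p + q) = F p + F q" "\<And>p q. F (p * q) = F p * F q"
      "\<And>c p. F (central_poly_scale scale c p) = bivariate_poly_scale c (F p)"
    unfolding algebra_isomorphic_def by blast
  have F_0: "F 0 = 0" using F(3)[of 0 0] by simp
  define \<iota> where "\<iota> r = F (Poly_Mapping.single 0 r)" for r
  define z where "z = F (Poly_Mapping.single 1 1)"
  have \<iota>: "\<iota> 1 = 1" "\<And>r s. \<iota> (r + s) = \<iota> r + \<iota> s" "\<And>r s. \<iota> (r * s) = \<iota> r * \<iota> s"
    by (simp_all add: \<iota>_def single_add mult_single F flip: F(2,3,4))
  have \<iota>_scale: "\<iota> (scale c r) = scalar c * \<iota> r" for c r
  proof -
    have "Poly_Mapping.single 0 (scale c r) = central_poly_scale scale c (Poly_Mapping.single (0::nat) r)"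
      by (simp add: central_poly_scale_eq mult_single scale_mult_left)
    then show ?thesis by (simp add: \<iota>_def F(5) bivariate_poly_scale_def scalar_def)
  qed
  have "inj \<iota>"
    unfolding \<iota>_def by (intro injI) (metis F(1) bij_def injD lookup_single_eq)
  have \<iota>_0: "\<iota> 0 = 0" by (simp add: \<iota>_def F_0)
  have \<iota>_minus: "\<iota> (- r) = - \<iota> r" for r
    using \<iota>(2)[of r "- r"] by (simp add: \<iota>_0 eq_neg_iff_add_eq_0 add.commute)
  have F_monomial: "F (Poly_Mapping.single n r) = \<iota> r * z ^ n" for n r
  proof (induction n)
    case 0
    then show ?case by (simp add: \<iota>_def)
  next
    case (Suc n)
    have "Poly_Mapping.single (Suc n) r = Poly_Mapping.single n r * Poly_Mapping.single 1 1"
      by (simp add: mult_single)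
    with Suc show ?case by (simp add: F(4) z_def mult_ac)
  qed
  have expand: "\<exists>p. (\<forall>n. coeff p n = \<iota> (Poly_Mapping.lookup q n)) \<and> poly p z = F q" for q
  proof (induction q rule: update_induct)
    case const
    show ?case by (rule exI[of _ 0]) (simp add: \<iota>_0 F_0)
  next
    case (update q m r)
    then obtain p where p: "\<And>n. coeff p n = \<iota> (Poly_Mapping.lookup q n)" "poly p z = F q" by blast
    from update(1) have q: "Poly_Mapping.update m r q = Poly_Mapping.single m r + q"
      by (intro poly_mapping_eqI)
        (auto simp: lookup_update lookup_add lookup_single when_def in_keys_iff)
    show ?case
      by (rule exI[of _ "monom (\<iota> r) m + p"])
        (auto simp: q lookup_add lookup_single when_def p \<iota>(2) \<iota>_0 F(3) F_monomial poly_monom)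
  qed
  interpret bivariate_over_subring "range \<iota>" z
  proof
    show "1 \<in> range \<iota>" using \<iota>(1) by (metis rangeI)
    show "a + b \<in> range \<iota>" if "a \<in> range \<iota>" "b \<in> range \<iota>" for a b
      using that by (auto simp flip: \<iota>(2))
    show "- a \<in> range \<iota>" if "a \<in> range \<iota>" for a
      using that by (auto simp flip: \<iota>_minus)
    show "a * b \<in> range \<iota>" if "a \<in> range \<iota>" "b \<in> range \<iota>" for a b
      using that by (auto simp flip: \<iota>(3))
    show "scalar c \<in> range \<iota>" for c
      using \<iota>_scale[of c 1] \<iota>(1) by (metis mult.right_neutral rangeI)
    show "\<exists>p. (\<forall>n. coeff p n \<in> range \<iota>) \<and> poly p z = b" for b
      using expand[of "inv F b"] F(1) by (metis bij_def rangeI surj_f_inv_f)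
    show "p = 0" if mem: "\<And>n. coeff p n \<in> range \<iota>" and p: "poly p z = 0" for p
    proof -
      \<comment> \<open>Pulling the coefficients back gives an element of \<open>R[z]\<close> in the kernel of the isomorphism.\<close>
      define c where "c n = inv \<iota> (coeff p n)" for n
      have \<iota>_c: "\<iota> (c n) = coeff p n" for n
        using mem by (simp add: c_def f_inv_into_f)
      have "inv \<iota> 0 = 0" using \<open>inj \<iota>\<close> \<iota>_0 by (metis inv_f_f)
      then have "{n. c n \<noteq> 0} \<subseteq> {..degree p}"
        by (auto simp: c_def intro: le_degree ccontr)
      then have "finite {n. c n \<noteq> 0}" by (rule finite_subset) simp
      then have lookup: "Poly_Mapping.lookup (Abs_poly_mapping c) = c" by simp
      obtain p' where p': "\<And>n. coeff p' n = \<iota> (c n)" "poly p' z = F (Abs_poly_mapping c)"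
        using expand[of "Abs_poly_mapping c"] by (auto simp: lookup)
      then have "p' = p" by (intro poly_eqI) (simp add: \<iota>_c)
      with p p'(2) have "F (Abs_poly_mapping c) = F 0" by (simp add: F_0)
      with F(1) have "Abs_poly_mapping c = 0" by (metis bij_def injD)
      then have "c n = 0" for n using lookup by (metis lookup_zero)
      with \<iota>_c show ?thesis by (intro poly_eqI) (metis \<iota>_0 coeff_0)
    qed
  qed
  from generated_by_f obtain f where inj: "inj (\<lambda>p. poly (map_poly scalar p) f)"
    and range: "range (\<lambda>p. poly (map_poly scalar p) f) = range \<iota>" by blast
  interpret ev: unital_ring_hom "\<lambda>p. poly (map_poly scalar p) f"
    by (rule scalar.unital_ring_hom_poly_map_poly)
  have ev_smult: "poly (map_poly scalar (smult c p)) f = scalar c * poly (map_poly scalar p) f" for c p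
  proof -
    have "map_poly scalar (smult c p) = smult (scalar c) (map_poly scalar p)"
      by (rule poly_eqI) (simp add: coeff_map_poly scalar.hom_mult)
    then show ?thesis by simp
  qed
  show ?thesis
    by (rule algebra_isomorphic_if_same_range[where s = "\<lambda>c b. scalar c * b",
          OF \<open>inj \<iota>\<close> inj range[symmetric] \<iota> \<iota>_scale ev.hom_one ev.hom_add ev.hom_mult ev_smult])
qed

end
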